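(* Let $G$ be a finite abelian group, let $m$ be a positive integer with $m \leq |G|$, and let $h \geq 2$ be an integer. Then $$\rho_{\pm}(G,m,h) = \min\{ |h_{\pm}A| \; : \; A \in \mathcal{A}(G,m)\}.$$
   Context: $G$ is written additively. For an $m$-subset $A=\{a_1,\dots,a_m\}$ of $G$ (with $m\ge 1$), the $h$-fold signed sumset is $$h_{\pm}A=\Big\{ \sum_{i=1}^m \lambda_i a_i \; : \; (\lambda_1,\dots,\lambda_m)\in\mathbb{Z}^m,\ \sum_{i=1}^m|\lambda_i|=h\Big\}.$$ For a positive integer $m\le |G|$, $\rho_{\pm}(G,m,h)=\min\{|h_{\pm}A| : A\subseteq G,\ |A|=m\}$. For $A \subseteq G$ write $-A=\{-a : a\in A\}$. A subset $A$ of $G$ is called symmetric if $A=-A$ (the empty set is symmetric); near-symmetric if $A$ is not symmetric but $A\setminus\{a\}$ is symmetric for some $a\in A$; and asymmetric if $A\cap(-A)=\emptyset$. $\mathcal{A}(G,m)$ is the collection of all $m$-element subsets of $G$ that are symmetric, near-symmetric, or asymmetric. *)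

theory Defs
  imports Main
begin

definition int_mult :: "int \<Rightarrow> 'a::ab_group_add \<Rightarrow> 'a" where
  "int_mult k a = (if 0 \<le> k then (\<Sum>i<nat k. a) else - (\<Sum>i<nat (- k). a))"

(* Since the a_i are distinct, an m-tuple of integer coefficients is a function on A;
   its values outside A play no role. *)
definition signed_sumset :: "nat \<Rightarrow> 'a::{ab_group_add, finite} set \<Rightarrow> 'a set" where
  "signed_sumset h A =
     {(\<Sum>a\<in>A. int_mult (c a) a) | c :: 'a \<Rightarrow> int. (\<Sum>a\<in>A. \<bar>c a\<bar>) = int h}"

(* The group G is the whole type 'a, passed as TYPE('a) because neither m, h nor the value
   mentions it. Meaningful for m \<le> card (UNIV :: 'a set); otherwise the Min is over {}. *)
definition rho_pm :: "'a::{ab_group_add, finite} itself \<Rightarrow> nat \<Rightarrow> nat \<Rightarrow> nat" where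
  "rho_pm G m h = Min {card (signed_sumset h A) | A :: 'a set. card A = m}"

definition symmetric :: "'a::ab_group_add set \<Rightarrow> bool" where
  "symmetric A \<longleftrightarrow> A = uminus ` A"

definition near_symmetric :: "'a::ab_group_add set \<Rightarrow> bool" where
  "near_symmetric A \<longleftrightarrow> \<not> symmetric A \<and> (\<exists>a\<in>A. symmetric (A - {a}))"

definition asymmetric :: "'a::ab_group_add set \<Rightarrow> bool" where
  "asymmetric A \<longleftrightarrow> A \<inter> uminus ` A = {}"

definition sym_family :: "'a::{ab_group_add, finite} itself \<Rightarrow> nat \<Rightarrow> 'a set set" where
  "sym_family G m = {A. card A = m \<and> (symmetric A \<or> near_symmetric A \<or> asymmetric A)}"

end

theory Submission
  imports Defs
begin

text \<open>
  If \<open>A\<close> contains a pair \<open>s, - s\<close>, then \<open>s + (- s) = 0\<close> can replace any cancelling pair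
  \<open>t + (- t)\<close> in a sum of \<open>h\<close> elements of \<open>A \<union> - A\<close>; hence the signed sumset of \<open>A\<close> is the
  ordinary \<open>h\<close>-fold sumset of \<open>A \<union> - A\<close>, and it contains the signed sumset of every subset of
  \<open>A \<union> - A\<close>. Such a subset, of the same size as \<open>A\<close> and symmetric or near-symmetric, arises by
  keeping \<open>A \<inter> - A\<close> and completing half of the remaining elements by their negatives. If there
  is no such pair, then \<open>A\<close> is asymmetric already.
\<close>

section \<open>Integer multiples\<close>

lemma int_mult_of_nat: "int_mult (int n) a = (\<Sum>i<n. a)"
  by (simp add: int_mult_def)

lemma int_mult_neg_of_nat: "int_mult (- int n) a = - (\<Sum>i<n. a)"
  by (simp add: int_mult_def)

lemma int_mult_0 [simp]: "int_mult 0 a = 0"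
  by (simp add: int_mult_def)

lemma int_mult_add_1: "int_mult (k + 1) a = int_mult k a + a"
proof (cases "0 \<le> k")
  case True
  then obtain n where "k = int n" using nonneg_int_cases by blast
  then show ?thesis
    using int_mult_of_nat[of n a] int_mult_of_nat[of "Suc n" a] by (simp add: add.commute)
next
  case False
  \<comment> \<open>Writing \<open>k\<close> as \<open>- int (Suc n)\<close> keeps
    \<open>k + 1 = - int n\<close> in the negated form, which is also valid at
    \<open>n = 0\<close>.\<close>
  then obtain n where n: "k = - int (Suc n)" by (metis int_cases linorder_not_le of_nat_0_le_iff)
  then have "k + 1 = - int n" by simp
  then show ?thesis
    using n int_mult_neg_of_nat[of n a] int_mult_neg_of_nat[of "Suc n" a] by simp
qed

lemma int_mult_add: "int_mult (k + l) a = int_mult k a + int_mult l a"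
proof (induction l rule: int_induct[where k = 0])
  case base
  then show ?case by simp
next
  case (step1 i)
  then show ?case using int_mult_add_1[of "k + i" a] int_mult_add_1[of i a]
    by (simp add: algebra_simps)
next
  case (step2 i)
  then show ?case using int_mult_add_1[of "k + i - 1" a] int_mult_add_1[of "i - 1" a]
    by (simp add: algebra_simps)
qed

lemma int_mult_1 [simp]: "int_mult 1 a = a"
  using int_mult_add_1[of 0 a] by simp

lemma int_mult_uminus_left: "int_mult (- k) a = - int_mult k a"
  using int_mult_add[of k "- k" a] by (simp add: eq_neg_iff_add_eq_0 add.commute)

lemma int_mult_uminus_right: "int_mult k (- a) = - int_mult k a"
  by (simp add: int_mult_def sum_negf)

section \<open>Signed sumsets against ordinary sumsets\<close>

lemma signed_sumsetI:
  assumes "(\<Sum>a\<in>A. \<bar>c a\<bar>) = int h" "x = (\<Sum>a\<in>A. int_mult (c a) a)"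
  shows "x \<in> signed_sumset h A"
  using assms unfolding signed_sumset_def by blast

lemma signed_sumsetE:
  assumes "x \<in> signed_sumset h A"
  obtains c where "(\<Sum>a\<in>A. \<bar>c a\<bar>) = int h" "x = (\<Sum>a\<in>A. int_mult (c a) a)"
  using assms unfolding signed_sumset_def by blast

text \<open>The ordinary sumset, repetition allowed, built one summand at a time to suit induction
  on \<open>h\<close>.\<close>

fun fold_sumset :: "nat \<Rightarrow> 'a::ab_group_add set \<Rightarrow> 'a set" where
  "fold_sumset 0 A = {0}"
| "fold_sumset (Suc h) A = {a + y | a y. a \<in> A \<and> y \<in> fold_sumset h A}"

lemma fold_sumset_mono: "A \<subseteq> B \<Longrightarrow> fold_sumset h A \<subseteq> fold_sumset h B"
  by (induction h) auto

text \<open>Serves to follow both the norm and the value of a combination when a single coefficient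
  changes.\<close>

lemma sum_change_one:
  fixes g :: "'b \<Rightarrow> 'c::ab_group_add"
  assumes "finite A" "a \<in> A" "\<And>b. b \<in> A \<Longrightarrow> b \<noteq> a \<Longrightarrow> f b = g b"
  shows "sum f A = sum g A - g a + f a"
proof -
  have "sum f (A - {a}) = sum g (A - {a})" using assms by (intro sum.cong) auto
  then show ?thesis using assms by (simp add: sum.remove[of A a])
qed

text \<open>Moving a nonzero coefficient one step towards 0 splits off a summand \<open>a\<close> or
  \<open>- a\<close> and lowers the norm by exactly one.\<close>

lemma signed_sumset_subset_fold_sumset:
  fixes A :: "'a::{ab_group_add, finite} set"
  shows "signed_sumset h A \<subseteq> fold_sumset h (A \<union> uminus ` A)"
proof (induction h)
  case 0
  show ?case
  proof
    fix x assume "x \<in> signed_sumset 0 A"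
    then obtain c where c: "(\<Sum>a\<in>A. \<bar>c a\<bar>) = 0" "x = (\<Sum>a\<in>A. int_mult (c a) a)"
      by (auto elim: signed_sumsetE)
    then have "\<forall>a\<in>A. c a = 0" by (simp add: sum_nonneg_eq_0_iff)
    then show "x \<in> fold_sumset 0 (A \<union> uminus ` A)" using c by simp
  qed
next
  case (Suc h)
  show ?case
  proof
    fix x assume "x \<in> signed_sumset (Suc h) A"
    then obtain c where c: "(\<Sum>a\<in>A. \<bar>c a\<bar>) = int (Suc h)" "x = (\<Sum>a\<in>A. int_mult (c a) a)"
      by (rule signed_sumsetE)
    then obtain a where a: "a \<in> A" "c a \<noteq> 0"
      by (metis abs_0 of_nat_neq_0 sum.neutral)
    define d where "d = c(a := c a - sgn (c a))"
    have "(\<Sum>b\<in>A. \<bar>d b\<bar>) = (\<Sum>b\<in>A. \<bar>c b\<bar>) - \<bar>c a\<bar> + \<bar>d a\<bar>"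
      by (rule sum_change_one) (auto simp: a d_def)
    also have "\<dots> = int h" using a c by (auto simp: d_def sgn_if)
    finally have norm: "(\<Sum>b\<in>A. \<bar>d b\<bar>) = int h" .
    have "(\<Sum>b\<in>A. int_mult (d b) b) = x - int_mult (c a) a + int_mult (d a) a"
      unfolding c by (rule sum_change_one) (auto simp: a d_def)
    then have "x = int_mult (sgn (c a)) a + (\<Sum>b\<in>A. int_mult (d b) b)"
      using int_mult_add[of "d a" "sgn (c a)" a] by (simp add: d_def)
    moreover have "int_mult (sgn (c a)) a \<in> A \<union> uminus ` A"
      using a int_mult_uminus_left[of 1 a] by (auto simp: sgn_if)
    moreover have "(\<Sum>b\<in>A. int_mult (d b) b) \<in> fold_sumset h (A \<union> uminus ` A)"
      using Suc.IH norm by (blast intro: signed_sumsetI)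
    ultimately show "x \<in> fold_sumset (Suc h) (A \<union> uminus ` A)" by auto
  qed
qed

text \<open>The relation \<open>s + (- s) = 0\<close> is spent on raising the norm by two at an
  unchanged value.\<close>

lemma signed_sumset_add_2:
  fixes A :: "'a::{ab_group_add, finite} set"
  assumes s: "s \<in> A" "- s \<in> A" and x: "x \<in> signed_sumset h A"
  shows "x \<in> signed_sumset (h + 2) A"
proof -
  obtain c where c: "(\<Sum>a\<in>A. \<bar>c a\<bar>) = int h" "x = (\<Sum>a\<in>A. int_mult (c a) a)"
    using x by (rule signed_sumsetE)
  show ?thesis
  proof (cases "s = - s")
    case True
    \<comment> \<open>Here \<open>s + s = 0\<close>, so the coefficient of \<open>s\<close> may move
      by two; the sign of \<open>e\<close> makes it move away from 0.\<close>
    define e :: int where "e = (if 0 \<le> c s then 1 else - 1)"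
    define d where "d = c(s := c s + e + e)"
    have "int_mult e s + int_mult e s = 0"
      using int_mult_uminus_right[of e s] True by (metis eq_neg_iff_add_eq_0)
    then have *: "int_mult (d s) s = int_mult (c s) s"
      by (simp only: d_def fun_upd_same int_mult_add add.assoc add_0_right)
    have "(\<Sum>b\<in>A. \<bar>d b\<bar>) = (\<Sum>b\<in>A. \<bar>c b\<bar>) - \<bar>c s\<bar> + \<bar>d s\<bar>"
      by (rule sum_change_one) (auto simp: s d_def)
    also have "\<dots> = int (h + 2)" using c by (auto simp: d_def e_def)
    finally show ?thesis
    proof (rule signed_sumsetI)
      show "x = (\<Sum>b\<in>A. int_mult (d b) b)"
        unfolding c using * by (intro sum.cong) (auto simp: d_def)
    qed
  next
    case False
    have split: "sum f A = f s + (f (- s) + sum f (A - {s, - s}))" for f :: "'a \<Rightarrow> 'b::ab_group_add"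
    proof -
      have "sum f A = f s + sum f (A - {s})" using s by (simp add: sum.remove)
      also have "sum f (A - {s}) = f (- s) + sum f (A - {s} - {- s})"
        using s False by (intro sum.remove) auto
      finally show ?thesis by (simp add: insert_Diff_if Diff_insert2[symmetric])
    qed
    \<comment> \<open>Only the difference of the coefficients at \<open>s\<close> and
      \<open>- s\<close> affects the value. If their signs agree, both move one step away from 0. If
      they are opposite, such a common shift could cancel, so the whole difference goes to one side
      and then 1 is added to both.\<close>
    obtain p q where pq: "\<bar>p\<bar> + \<bar>q\<bar> = \<bar>c s\<bar> + \<bar>c (- s)\<bar> + 2" "p - q = c s - c (- s)"
    proof -
      consider "0 \<le> c s" "0 \<le> c (- s)" | "c s \<le> 0" "c (- s) \<le> 0"
        | "0 \<le> c s" "c (- s) \<le> 0" | "c s \<le> 0" "0 \<le> c (- s)" by linarith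
      then show thesis
      proof cases
        case 1 then show ?thesis by (intro that[of "c s + 1" "c (- s) + 1"]) auto
      next
        case 2 then show ?thesis by (intro that[of "c s - 1" "c (- s) - 1"]) auto
      next
        case 3 then show ?thesis by (intro that[of "c s - c (- s) + 1" 1]) auto
      next
        case 4 then show ?thesis by (intro that[of 1 "c (- s) - c s + 1"]) auto
      qed
    qed
    define d where "d = c(s := p, - s := q)"
    have d: "d s = p" "d (- s) = q" using False by (auto simp: d_def)
    have rest: "(\<Sum>b\<in>A - {s, - s}. f (d b) b) = (\<Sum>b\<in>A - {s, - s}. f (c b) b)"
      for f :: "int \<Rightarrow> 'a \<Rightarrow> 'b::ab_group_add"
      by (rule sum.cong) (auto simp: d_def)
    have pair: "int_mult i s + int_mult j (- s) = int_mult (i - j) s" for i j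
      using int_mult_add[of i "- j" s] by (simp add: int_mult_uminus_left int_mult_uminus_right)
    have "(\<Sum>b\<in>A. \<bar>d b\<bar>) = int (h + 2)"
      using c(1) pq(1) d rest[of "\<lambda>k b. \<bar>k\<bar>"]
        split[of "\<lambda>b. \<bar>c b\<bar>"] split[of "\<lambda>b. \<bar>d b\<bar>"] by simp
    then show ?thesis
    proof (rule signed_sumsetI)
      show "x = (\<Sum>b\<in>A. int_mult (d b) b)"
        using pair[of p q] pair[of "c s" "c (- s)"] pq(2) d rest[of int_mult]
        by (simp add: c(2) split[of "\<lambda>b. int_mult (c b) b"] split[of "\<lambda>b. int_mult (d b) b"]
              add.assoc[symmetric])
    qed
  qed
qed

text \<open>A new summand \<open>a\<close> or \<open>- a\<close> either raises the norm to
  \<open>h + 1\<close> or cancels and lowers it to \<open>h - 1\<close>; in the second case the pair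
  \<open>s\<close>, \<open>- s\<close> makes up the missing two.\<close>

lemma fold_sumset_subset_signed_sumset:
  fixes A :: "'a::{ab_group_add, finite} set"
  assumes s: "s \<in> A" "- s \<in> A"
  shows "fold_sumset h (A \<union> uminus ` A) \<subseteq> signed_sumset h A"
proof (induction h)
  case 0
  show ?case by (auto intro: signed_sumsetI[where c = "\<lambda>_. 0"])
next
  case (Suc h)
  show ?case
  proof
    fix x assume "x \<in> fold_sumset (Suc h) (A \<union> uminus ` A)"
    then obtain u y where x: "x = u + y" and u: "u \<in> A \<union> uminus ` A"
      and y: "y \<in> fold_sumset h (A \<union> uminus ` A)" by auto
    obtain c where c: "(\<Sum>a\<in>A. \<bar>c a\<bar>) = int h" "y = (\<Sum>a\<in>A. int_mult (c a) a)"
      using Suc.IH y by (blast elim: signed_sumsetE)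
    obtain a and e :: int where a: "a \<in> A" "u = int_mult e a" and e: "e = 1 \<or> e = - 1"
      using u int_mult_1 int_mult_uminus_left by (metis UnE imageE)
    define d where "d = c(a := c a + e)"
    have "(\<Sum>b\<in>A. \<bar>d b\<bar>) = (\<Sum>b\<in>A. \<bar>c b\<bar>) - \<bar>c a\<bar> + \<bar>d a\<bar>"
      by (rule sum_change_one) (auto simp: a d_def)
    then have norm: "(\<Sum>b\<in>A. \<bar>d b\<bar>) = int h - \<bar>c a\<bar> + \<bar>c a + e\<bar>" by (simp add: c d_def)
    have "(\<Sum>b\<in>A. int_mult (d b) b) = y - int_mult (c a) a + int_mult (d a) a"
      unfolding c by (rule sum_change_one) (auto simp: a d_def)
    then have val: "x = (\<Sum>b\<in>A. int_mult (d b) b)"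
      by (simp add: x a d_def int_mult_add)
    show "x \<in> signed_sumset (Suc h) A"
    proof (cases "\<bar>c a + e\<bar> = \<bar>c a\<bar> + 1")
      case True
      then show ?thesis using norm val by (intro signed_sumsetI[where c = d]) auto
    next
      case False
      then have less: "(\<Sum>b\<in>A. \<bar>d b\<bar>) = int h - 1" using e norm by auto
      moreover have "0 \<le> (\<Sum>b\<in>A. \<bar>d b\<bar>)" by (simp add: sum_nonneg)
      \<comment> \<open>A norm is nonnegative, so a cancellation forces \<open>h\<close> to be
        positive.\<close>
      ultimately obtain k where k: "h = Suc k" by (cases h) auto
      then have "x \<in> signed_sumset k A"
        using less val by (intro signed_sumsetI[where c = d]) auto
      then show ?thesis using signed_sumset_add_2[OF s] k by simp
    qed
  qed
qed

text \<open>The detour through ordinary sumsets gives monotonicity, since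
  \<open>A \<union> uminus\<close> A\<open>is closed under negation and so contains\<close>uminus
  \<open>B\<close> too.\<close>

lemma signed_sumset_subset:
  fixes A :: "'a::{ab_group_add, finite} set"
  assumes "s \<in> A" "- s \<in> A" "B \<subseteq> A \<union> uminus ` A"
  shows "signed_sumset h B \<subseteq> signed_sumset h A"
proof -
  have "signed_sumset h B \<subseteq> fold_sumset h (B \<union> uminus ` B)"
    by (rule signed_sumset_subset_fold_sumset)
  also have "\<dots> \<subseteq> fold_sumset h (A \<union> uminus ` A)"
    using assms by (intro fold_sumset_mono) fastforce
  also have "\<dots> \<subseteq> signed_sumset h A"
    using assms by (intro fold_sumset_subset_signed_sumset)
  finally show ?thesis .
qed

section \<open>The symmetric or near-symmetric replacement\<close>

lemma exists_symmetric_or_near_symmetric: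
  fixes A :: "'a::{ab_group_add, finite} set"
  obtains B where "card B = card A" "B \<subseteq> A \<union> uminus ` A" "symmetric B \<or> near_symmetric B"
proof -
  define S where "S = A \<inter> uminus ` A"
  define T where "T = A - uminus ` A"
  have mem_neg: "x \<in> uminus ` X \<longleftrightarrow> - x \<in> X" for x :: 'a and X
    by (metis image_iff minus_minus)
  obtain R where R: "R \<subseteq> T" "card R = card T div 2"
    using obtain_subset_with_card_n[of "card T div 2" T] by (metis div_le_dividend)
  define C where "C = S \<union> (R \<union> uminus ` R)"
  have sym: "symmetric C"
    unfolding symmetric_def C_def S_def by (auto simp: mem_neg)
  have sub: "C \<subseteq> A \<union> uminus ` A"
    using R unfolding C_def S_def T_def by auto
  have cardA: "card A = card S + card T"
    using card_Int_Diff[of A "uminus ` A"] unfolding S_def T_def by simp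
  have "card (R \<union> uminus ` R) = card R + card R"
    using R unfolding T_def
    by (subst card_Un_disjoint) (auto simp: card_image)
  moreover have "card C = card S + card (R \<union> uminus ` R)"
    unfolding C_def using R unfolding S_def T_def
    by (intro card_Un_disjoint) (auto simp: mem_neg)
  ultimately have cardC: "card C = card S + 2 * (card T div 2)" using R by simp
  show thesis
  proof (cases "even (card T)")
    case True
    then show thesis using sym sub cardA cardC by (intro that[of C]) auto
  next
    case False
    \<comment> \<open>For odd \<open>card T\<close> the set \<open>C\<close> is one element short.
      An element \<open>t\<close> of \<open>T\<close> left over by \<open>R\<close> fills the gap;
      as \<open>- t\<close> is neither in \<open>C\<close> nor equal to \<open>t\<close>, the result
      is near-symmetric.\<close>
    then have "card T div 2 \<noteq> card T" by presburger
    then have "R \<noteq> T" using R by auto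
    then obtain t where t: "t \<in> T" "t \<notin> R" using R by blast
    have tC: "t \<notin> C" "- t \<notin> C" "t \<noteq> - t"
      using t R unfolding C_def S_def T_def by (auto simp: mem_neg)
    have "\<not> symmetric (insert t C)"
      using tC unfolding symmetric_def by (metis imageI insertE insertI1)
    moreover have "insert t C - {t} = C" using tC by simp
    ultimately have "near_symmetric (insert t C)"
      using sym unfolding near_symmetric_def by (metis insertI1)
    moreover have "card (insert t C) = card A"
      using tC cardA cardC False by (simp add: odd_two_times_div_two_succ)
    moreover have "insert t C \<subseteq> A \<union> uminus ` A" using sub t unfolding T_def by auto
    ultimately show thesis using that by blast
  qed
qed

section \<open>Comparison of the minima\<close>

lemma sym_family_card_le:
  fixes A :: "'a::{ab_group_add, finite} set"
  obtains B where "B \<in> sym_family TYPE('a) (card A)"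
    "card (signed_sumset h B) \<le> card (signed_sumset h A)"
proof (cases "asymmetric A")
  case True
  then show thesis using that[of A] by (simp add: sym_family_def)
next
  case False
  \<comment> \<open>The pair may be degenerate, with \<open>s = - s\<close>, for instance when
    \<open>A\<close> contains 0.\<close>
  then obtain s where s: "s \<in> A" "- s \<in> A" unfolding asymmetric_def by auto
  obtain B where B: "card B = card A" "B \<subseteq> A \<union> uminus ` A" "symmetric B \<or> near_symmetric B"
    by (rule exists_symmetric_or_near_symmetric)
  then have "B \<in> sym_family TYPE('a) (card A)" by (auto simp: sym_family_def)
  moreover have "card (signed_sumset h B) \<le> card (signed_sumset h A)"
    using signed_sumset_subset[OF s B(2)] by (simp add: card_mono)
  ultimately show thesis by (rule that)
qed

theorem theorem3:
  fixes m h :: nat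
  assumes "1 \<le> m" and "m \<le> card (UNIV :: 'a::{ab_group_add, finite} set)" and "2 \<le> h"
  shows "rho_pm TYPE('a) m h = Min {card (signed_sumset h A) | A. A \<in> sym_family TYPE('a) m}"
proof -
  let ?X = "{card (signed_sumset h A) | A :: 'a set. card A = m}"
  let ?Y = "{card (signed_sumset h A) | A :: 'a set. A \<in> sym_family TYPE('a) m}"
  have fin: "finite ?X" by simp
  have sub: "?Y \<subseteq> ?X" by (auto simp: sym_family_def)
  then have finY: "finite ?Y" using fin by (rule finite_subset)
  \<comment> \<open>The bound on \<open>m\<close> makes both minima range over nonempty sets, so
    that a minimiser \<open>A\<close> exists and can be replaced by some \<open>B\<close> in the
    family.\<close>
  obtain A :: "'a set" where "card A = m" using obtain_subset_with_card_n[OF assms(2)] by metis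
  then have "?X \<noteq> {}" by blast
  then have "Min ?X \<in> ?X" using fin by (rule Min_in[rotated])
  then obtain A :: "'a set" where A: "card A = m" "Min ?X = card (signed_sumset h A)" by auto
  obtain B where B: "B \<in> sym_family TYPE('a) (card A)"
    "card (signed_sumset h B) \<le> card (signed_sumset h A)"
    by (rule sym_family_card_le)
  have memY: "card (signed_sumset h B) \<in> ?Y" using A B by blast
  have "Min ?Y \<le> Min ?X" using Min_le[OF finY memY] A B by linarith
  moreover have "Min ?X \<le> Min ?Y" using sub fin memY by (intro Min_antimono) auto
  ultimately show ?thesis unfolding rho_pm_def by simp
qed

end
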